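(* Let $q=p^h$ where $p>5$ is a prime and $q\not\equiv 0\pmod 3$, and let $A_q$ and $\Pi_q$ be the affine plane and the projective plane of order $q$ represented by a planar function $f:\mathrm{GF}(q)\to\mathrm{GF}(q)$. Then \[\overline{\chi}_b(A_q)\ \ge\ \begin{cases}\frac{(1-\frac1p)q^2}{3} & \text{if } p=3k+1,\\[2pt] \frac{(1-\frac2p)q^2}{3} & \text{if } p=3k+2;\end{cases}\] \[\overline{\chi}_b(\Pi_q)\ \ge\ \begin{cases}\frac{q^2+q-1-\frac{q^2}{p}}{3} & \text{if } p=3k+1,\\[2pt] \frac{q^2+q+1-\frac{2q^2}{p}}{3} & \text{if } p=3k+2,\ h \text{ odd},\\[2pt] \frac{q^2+q-1-\frac{2q^2}{p}}{3} & \text{if } p=3k+2,\ h \text{ even}.\end{cases}\]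
   Context: For a hypergraph with vertex set $V$ and edge set $E$, a strict $N$-coloring is a partition of $V$ into exactly $N$ nonempty color classes. An edge is rainbow if no two of its vertices have the same color. A coloring is proper (rainbow-free) if no edge is rainbow, and balanced if the sizes of any two color classes differ by at most one. The balanced upper chromatic number $\overline{\chi}_b$ of a hypergraph is the largest $N$ such that it admits a proper strict balanced $N$-coloring. A projective (or affine) plane is regarded as the hypergraph whose vertices are the points and whose edges are the lines. A function $f:\mathrm{GF}(q)\to\mathrm{GF}(q)$ is a planar function if for every $a\neq 0$ and every $b\in\mathrm{GF}(q)$ the equation $f(x+a)-f(x)=b$ has a unique solution $x$. The affine plane $A_q$ represented by $f$ has point set $\mathrm{GF}(q)^2$; its lines are the vertical lines $\{(c,y):y\in\mathrm{GF}(q)\}$, $c\in\mathrm{GF}(q)$, and the translates $\{(x+a,f(x)+b):x\in\mathrm{GF}(q)\}$, $a,b\in\mathrm{GF}(q)$, of the graph of $f$. Its parallel classes are the vertical lines, and for each $a$ the translates with that $a$. The projective plane $\Pi_q$ represented by $f$ is the projective closure of $A_q$: one ideal point is added to each parallel class, and the ideal line consists of all ideal points. *)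

theory Defs
  imports Complex_Main "HOL-Library.Disjoint_Sets" "HOL-Library.Cardinality" "HOL-Computational_Algebra.Primes"
begin

text \<open>
  A hypergraph is given by its vertex set \<open>V\<close> and its edge set \<open>E\<close>; a coloring is
  identified with its set of color classes, a partition \<open>P\<close> of \<open>V\<close>.
\<close>

definition strict_coloring :: "'v set \<Rightarrow> nat \<Rightarrow> 'v set set \<Rightarrow> bool" where
  "strict_coloring V N P \<longleftrightarrow> finite P \<and> partition_on V P \<and> card P = N"

definition rainbow :: "'v set set \<Rightarrow> 'v set \<Rightarrow> bool" where
  "rainbow P e \<longleftrightarrow> (\<forall>x\<in>e. \<forall>y\<in>e. x \<noteq> y \<longrightarrow> \<not> (\<exists>C\<in>P. x \<in> C \<and> y \<in> C))"

definition proper_coloring :: "'v set set \<Rightarrow> 'v set set \<Rightarrow> bool" where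
  "proper_coloring E P \<longleftrightarrow> (\<forall>e\<in>E. \<not> rainbow P e)"

definition balanced_coloring :: "'v set set \<Rightarrow> bool" where
  "balanced_coloring P \<longleftrightarrow> (\<forall>C\<in>P. \<forall>D\<in>P. \<bar>int (card C) - int (card D)\<bar> \<le> 1)"

text \<open>
  The maximum below exists whenever \<open>V\<close> is finite and nonempty and every edge contains at least
  two vertices of \<open>V\<close>: the trivial coloring with one class is admissible, and \<open>N \<le> card V\<close>.
\<close>

definition balanced_upper_chromatic_number :: "'v set \<Rightarrow> 'v set set \<Rightarrow> nat" where
  "balanced_upper_chromatic_number V E =
     Max {N. \<exists>P. strict_coloring V N P \<and> proper_coloring E P \<and> balanced_coloring P}"

definition planar_function :: "('a::field \<Rightarrow> 'a) \<Rightarrow> bool" where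
  "planar_function f \<longleftrightarrow> (\<forall>a b. a \<noteq> 0 \<longrightarrow> (\<exists>!x. f (x + a) - f x = b))"

definition vertical_line :: "'a \<Rightarrow> ('a \<times> 'a) set" where
  "vertical_line c = {(c, y) | y. True}"

definition translate_line :: "('a::field \<Rightarrow> 'a) \<Rightarrow> 'a \<Rightarrow> 'a \<Rightarrow> ('a \<times> 'a) set" where
  "translate_line f a b = {(x + a, f x + b) | x. True}"

definition parallel_classes :: "('a::field \<Rightarrow> 'a) \<Rightarrow> ('a \<times> 'a) set set set" where
  "parallel_classes f = insert (range vertical_line) (range (\<lambda>a. range (translate_line f a)))"

definition affine_points :: "('a \<times> 'a) set" where
  "affine_points = UNIV"

definition affine_lines :: "('a::field \<Rightarrow> 'a) \<Rightarrow> ('a \<times> 'a) set set" where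
  "affine_lines f = \<Union> (parallel_classes f)"

text \<open>
  In the projective closure, \<open>Inl\<close> marks the affine points, and the ideal point of a parallel
  class \<open>K\<close> is \<open>Inr K\<close>.
\<close>

type_synonym 'a proj_point = "('a \<times> 'a) + ('a \<times> 'a) set set"

definition projective_points :: "('a::field \<Rightarrow> 'a) \<Rightarrow> 'a proj_point set" where
  "projective_points f = Inl ` affine_points \<union> Inr ` parallel_classes f"

definition ideal_line :: "('a::field \<Rightarrow> 'a) \<Rightarrow> 'a proj_point set" where
  "ideal_line f = Inr ` parallel_classes f"

definition projective_lines :: "('a::field \<Rightarrow> 'a) \<Rightarrow> 'a proj_point set set" where
  "projective_lines f =
     insert (ideal_line f) {insert (Inr K) (Inl ` l) | K l. K \<in> parallel_classes f \<and> l \<in> K}"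

definition chi_b_affine :: "('a::field \<Rightarrow> 'a) \<Rightarrow> nat" where
  "chi_b_affine f = balanced_upper_chromatic_number affine_points (affine_lines f)"

definition chi_b_projective :: "('a::field \<Rightarrow> 'a) \<Rightarrow> nat" where
  "chi_b_projective f = balanced_upper_chromatic_number (projective_points f) (projective_lines f)"

end

theory Submission
  imports Defs "HOL-Library.Product_Plus" "HOL-Number_Theory.Cong"
begin

text \<open>
  Take three points \<open>P\<close>, \<open>P + a\<close>, \<open>P + b\<close> on the graph of \<open>f\<close>, over \<open>0\<close>, \<open>2\<close> and \<open>1\<close>; planarity makes \<open>a\<close>
  and \<open>b\<close> independent over the prime field. Every translate of the graph contains a translate
  \<open>{t, t + a, t + b}\<close>, and any two points of it lie in a reflected triangle \<open>{c, c - a, c - b}\<close>, where \<open>c\<close>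
  is \<open>t + a\<close>, \<open>t + b\<close> or \<open>t + a + b\<close>. If \<open>\<phi>\<close> is an additive map to the integers modulo \<open>p\<close> with
  \<open>\<phi> a = 1\<close> and \<open>\<phi> b = 2\<close>, then the three candidates for \<open>c\<close> have consecutive values of \<open>\<phi>\<close>, so that
  almost always one of them is a nonzero multiple of \<open>3\<close>; the reflected triangles with these \<open>c\<close> are
  disjoint and miss only one or two levels of \<open>\<phi>\<close>. The missed points are added to triangles so as to
  cover the remaining translates. The points of level \<open>0\<close> also cover all vertical lines, as the
  vector \<open>2b - a\<close> is vertical. In the projective plane the ideal points are colored separately.
\<close>

section \<open>Additive functionals on a finite field\<close>

lemma of_int_eq_if_cong:
  assumes "[i = j] (mod int p)" and "of_nat p = (0 :: 'a :: comm_ring_1)"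
  shows "of_int i = (of_int j :: 'a)"
proof -
  obtain c where "i - j = int p * c"
    using assms(1) by (auto simp: cong_iff_dvd_diff)
  then have "of_int (i - j) = (of_nat p * of_int c :: 'a)"
    by simp
  then show ?thesis
    using assms(2) by simp
qed

text \<open>Translation by \<open>1\<close> permutes the field, so adding \<open>1\<close> to each
  element leaves the total sum unchanged. Hence \<open>p ^ h\<close> vanishes in the field, and so
  does \<open>p\<close>.\<close>

lemma of_nat_prime_eq_0_if_card:
  assumes "CARD('a::{field,finite}) = p ^ h"
  shows "of_nat p = (0 :: 'a)"
proof -
  have "(\<Sum>x\<in>UNIV. x + (1::'a)) = (\<Sum>x\<in>UNIV. x)"
    by (rule sum.reindex_bij_betw) (simp add: bij_plus_right)
  then have "of_nat CARD('a) = (0 :: 'a)"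
    by (simp add: sum.distrib)
  then show ?thesis
    using assms by simp
qed

text \<open>
  The functional is the projection along a maximal additive subgroup \<open>H\<close> that avoids \<open>1\<close>; such an
  \<open>H\<close> is automatically a complement of the prime field.
\<close>

lemma additive_functional_exists:
  assumes p: "prime p" and char: "of_nat p = (0 :: 'a :: {field,finite})"
  obtains \<psi> :: "'a :: {field,finite} \<Rightarrow> int"
  where "\<And>x y. [\<psi> (x + y) = \<psi> x + \<psi> y] (mod int p)" and "\<And>i. [\<psi> (of_int i) = i] (mod int p)"
proof -
  define sgrp where "sgrp H \<longleftrightarrow> 0 \<in> H \<and> (\<forall>x\<in>H. \<forall>y\<in>H. x - y \<in> H)" for H :: "'a set"
  have "{0} \<in> {H. sgrp H \<and> (1::'a) \<notin> H}"
    by (auto simp: sgrp_def)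
  then obtain H where H: "sgrp H" "1 \<notin> H"
    and max: "\<And>K. sgrp K \<Longrightarrow> 1 \<notin> K \<Longrightarrow> H \<subseteq> K \<Longrightarrow> H = K"
    using finite_has_maximal[of "{H. sgrp H \<and> (1::'a) \<notin> H}"] by (metis (lifting) empty_iff finite mem_Collect_eq)
  have zero: "0 \<in> H" and diff: "\<And>x y. x \<in> H \<Longrightarrow> y \<in> H \<Longrightarrow> x - y \<in> H"
    using H(1) by (auto simp: sgrp_def)
  have neg: "- x \<in> H" if "x \<in> H" for x
    using diff[OF zero that] by simp
  have add: "x + y \<in> H" if "x \<in> H" "y \<in> H" for x y
    using diff[OF that(1) neg[OF that(2)]] by simp
  have mult: "of_int i * x \<in> H" if "x \<in> H" for i x
  proof (induction i rule: int_induct[where k = 0])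
    case base
    show ?case using zero by simp
  next
    case (step1 i)
    then show ?case using add[OF step1(2) that] by (simp add: algebra_simps)
  next
    case (step2 i)
    then show ?case using diff[OF step2(2) that] by (simp add: algebra_simps)
  qed
  have inverse: "\<exists>j. of_int j * of_int i = (1::'a)" if "\<not> int p dvd i" for i
  proof -
    have "coprime i (int p)"
      using that p by (metis coprime_commute prime_imp_coprime prime_int_nat_transfer prime_nat_int_transfer)
    then obtain j where "[i * j = 1] (mod int p)"
      using cong_solve_coprime_int by blast
    from of_int_eq_if_cong[OF this char] show ?thesis
      by (auto simp: mult.commute)
  qed
  \<comment> \<open>Otherwise \<open>i\<close> is invertible, and a multiple of
    \<open>of_int i\<close> would put \<open>1\<close> into \<open>H\<close>.\<close>
  have uniq: "int p dvd i" if "of_int i \<in> H" for i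
    using inverse[of i] mult[OF that] H(2) by metis
  have ex: "\<exists>r. x - of_int r \<in> H" for x
  proof (cases "x \<in> H")
    case True
    then show ?thesis by (intro exI[of _ 0]) simp
  next
    case False
    \<comment> \<open>\<open>K\<close> is the subgroup generated by \<open>H\<close> and
      \<open>x\<close>. Maximality gives \<open>1 \<in> K\<close>; as \<open>1\<close> is not in
      \<open>H\<close>, the coefficient of \<open>x\<close> in \<open>1\<close> is invertible, and
      the equation can be solved for \<open>x\<close> modulo \<open>H\<close>.\<close>
    define K where "K = {y + of_int i * x | y i. y \<in> H}"
    have "H \<subseteq> K"
      unfolding K_def by (smt (verit) add.right_neutral mem_Collect_eq mult_zero_left of_int_0 subsetI)
    moreover have "x \<in> K"
      unfolding K_def using zero by (smt (verit) add_0 mem_Collect_eq mult_1 of_int_1)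
    moreover have "sgrp K"
      unfolding sgrp_def
    proof (intro conjI ballI)
      show "0 \<in> K"
        using \<open>H \<subseteq> K\<close> zero by blast
      fix u v assume "u \<in> K" "v \<in> K"
      then obtain y i z j where "y \<in> H" "z \<in> H" "u = y + of_int i * x" "v = z + of_int j * x"
        unfolding K_def by blast
      then have "u - v = (y - z) + of_int (i - j) * x" "y - z \<in> H"
        using diff by (auto simp: algebra_simps)
      then show "u - v \<in> K"
        unfolding K_def by blast
    qed
    ultimately have "1 \<in> K"
      using max False by blast
    then obtain y i where y: "y \<in> H" "1 = y + of_int i * x"
      unfolding K_def by blast
    have "\<not> int p dvd i"
    proof
      assume "int p dvd i"
      then have "of_int i = (0::'a)"
        using of_int_eq_if_cong[of i 0 p] char by (simp add: cong_0_iff)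
      then show False using y H(2) by simp
    qed
    then obtain j where j: "of_int j * of_int i = (1::'a)"
      using inverse by blast
    have "x = of_int j * (of_int i * x)"
      using j by (simp add: mult.assoc[symmetric])
    also have "of_int i * x = 1 - y"
      using y(2) by (simp add: algebra_simps)
    finally have "x - of_int j = - (of_int j * y)"
      by (simp add: algebra_simps)
    then show ?thesis
      using neg[OF mult[OF y(1)]] by metis
  qed
  then obtain \<psi> where \<psi>: "x - of_int (\<psi> x) \<in> H" for x
    by metis
  show thesis
  proof
    fix x y
    \<comment> \<open>The defect of additivity is an integer whose image lies in \<open>H\<close>,
      hence a multiple of \<open>p\<close>.\<close>
    have "of_int (\<psi> (x + y) - (\<psi> x + \<psi> y))
        = (x - of_int (\<psi> x)) + (y - of_int (\<psi> y)) - (x + y - of_int (\<psi> (x + y)))"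
      by simp
    also have "\<dots> \<in> H"
      by (intro diff add \<psi>)
    finally show "[\<psi> (x + y) = \<psi> x + \<psi> y] (mod int p)"
      using uniq by (simp add: cong_iff_dvd_diff)
  next
    fix i
    have "of_int (\<psi> (of_int i) - i) \<in> H"
      using neg[OF \<psi>[of "of_int i"]] by simp
    then show "[\<psi> (of_int i) = i] (mod int p)"
      using uniq by (simp add: cong_iff_dvd_diff)
  qed
qed

section \<open>Colorings by reflected triangles\<close>

text \<open>\<open>\<phi>\<close> is a homomorphism to the integers modulo \<open>p\<close>,
  recorded by its least nonnegative residue: the construction depends on the order of the levels and
  on their residues modulo 3, so every wrap-around at \<open>p\<close> has to be tracked.\<close>

locale triangle_coloring =
  fixes p k :: nat and \<phi> :: "'g::{ab_group_add,finite} \<Rightarrow> nat" and a b :: 'g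
  assumes p: "p = 3 * k + 1 \<or> p = 3 * k + 2" and k: "k \<ge> 2"
    and less: "\<phi> v < p"
    and add: "\<phi> (u + v) = (\<phi> u + \<phi> v) mod p"
    and a: "\<phi> a = 1" and b: "\<phi> b = 2"
begin

lemma add_a: "\<phi> (v + a) = (if \<phi> v + 1 = p then 0 else \<phi> v + 1)"
  using add[of v a] a less[of v] by auto

lemma add_b: "\<phi> (v + b) = (if \<phi> v + 1 = p then 1 else if \<phi> v + 2 = p then 0 else \<phi> v + 2)"
proof -
  have "\<phi> v + 2 = p + 1" if "\<phi> v + 1 = p" using that by simp
  moreover have "(p + 1) mod p = 1" using p k by (auto simp: mod_Suc)
  ultimately show ?thesis
    using add[of v b] b less[of v] by auto
qed

text \<open>
  The levels \<open>0\<close> and \<open>3k + 1\<close> (the latter is empty if \<open>p = 3k + 1\<close>) are not covered by the triangles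
  \<open>{c, c - a, c - b}\<close>; their points join the triangles centered on the levels \<open>3\<close> and \<open>3k\<close>, respectively.
\<close>

definition center :: "'g \<Rightarrow> 'g" where
  "center v = (if \<phi> v = 0 then v + (b + b - a) else if \<phi> v = 3 * k + 1 then v - a
     else if \<phi> v mod 3 = 0 then v else if \<phi> v mod 3 = 1 then v + b else v + a)"

definition centers :: "'g set" where
  "centers = {c. \<phi> c \<in> (\<lambda>i. 3 * i) ` {1..k}}"

definition triangle_classes :: "'g set set" where
  "triangle_classes = (\<lambda>c. center -` {c}) ` centers"

section \<open>Fibres of the center map\<close>

lemma mem_centers_iff: "c \<in> centers \<longleftrightarrow> 0 < \<phi> c \<and> \<phi> c \<le> 3 * k \<and> \<phi> c mod 3 = 0"
  unfolding centers_def by (auto simp: image_iff)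

lemma diff_a: "\<phi> (v - a) = (if \<phi> v = 0 then p - 1 else \<phi> v - 1)"
  using add_a[of "v - a"] less[of "v - a"] by (auto split: if_splits)

lemma diff_b: "2 \<le> \<phi> v \<Longrightarrow> \<phi> (v - b) = \<phi> v - 2"
  using add_b[of "v - b"] less[of "v - b"] by (auto split: if_splits)

lemma add_bba: "\<phi> v = 0 \<Longrightarrow> \<phi> (v + (b + b - a)) = 3"
proof -
  assume "\<phi> v = 0"
  then have "\<phi> (v + b + b) = 4" using p k add_b[of v] add_b[of "v + b"] by auto
  then show ?thesis using diff_a[of "v + b + b"] by (simp add: algebra_simps)
qed

lemma diff_bba: "\<phi> v = 3 \<Longrightarrow> \<phi> (v - (b + b - a)) = 0"
proof -
  assume *: "\<phi> v = 3"
  \<comment> \<open>With \<open>a\<close> added first, each \<open>b\<close> is subtracted from a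
    level at least 2, as \<open>diff_b\<close> demands.\<close>
  then have "\<phi> (v + a) = 4" using p k add_a[of v] by auto
  then have "\<phi> (v + a - b - b) = 0" using diff_b[of "v + a"] diff_b[of "v + a - b"] by simp
  then show ?thesis by (simp add: algebra_simps)
qed

text \<open>Ordinary levels are rounded up to the next multiple of 3, which is at most
  \<open>3 * k\<close> and hence reached without wrap-around; level 0 goes to 3, and level
  \<open>3 * k + 1\<close> down to \<open>3 * k\<close>.\<close>

lemma center_in_centers: "center v \<in> centers"
proof -
  have [simp]: "\<phi> v = 0 \<Longrightarrow> center v \<in> centers"
    using add_bba[of v] k by (auto simp: center_def mem_centers_iff)
  have [simp]: "\<phi> v = 3 * k + 1 \<Longrightarrow> center v \<in> centers"
    using diff_a[of v] k by (auto simp: center_def mem_centers_iff)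
  have [simp]: "\<phi> v \<le> 3 * k" if "\<phi> v \<noteq> 3 * k + 1"
    using that less[of v] p by linarith
  show ?thesis
  proof (cases "\<phi> v = 0 \<or> \<phi> v = 3 * k + 1")
    case False
    then have le: "\<phi> v \<le> 3 * k" and pos: "\<phi> v > 0" by auto
    consider "\<phi> v mod 3 = 0" | "\<phi> v mod 3 = 1" | "\<phi> v mod 3 = 2" by linarith
    then show ?thesis
    proof cases
      case 1 then show ?thesis using False le pos by (simp add: center_def mem_centers_iff)
    next
      case 2
      then have "\<phi> v + 2 \<le> 3 * k" "(\<phi> v + 2) mod 3 = 0" using le by presburger+
      moreover from this have "\<phi> v + 2 \<noteq> p" "\<phi> v + 1 \<noteq> p" using p by linarith+
      ultimately show ?thesis using 2 False by (simp add: center_def mem_centers_iff add_b)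
    next
      case 3
      then have "\<phi> v + 1 \<le> 3 * k" "(\<phi> v + 1) mod 3 = 0" using le by presburger+
      moreover from this have "\<phi> v + 1 \<noteq> p" using p by linarith
      ultimately show ?thesis using 3 False by (simp add: center_def mem_centers_iff add_a)
    qed
  qed auto
qed

lemma center_fixed: "c \<in> centers \<Longrightarrow> center c = c"
  by (auto simp: center_def mem_centers_iff)

text \<open>Each branch of \<open>center\<close> is inverted. The last summand depends on
  \<open>p\<close>: if \<open>p = 3 * k + 1\<close> and \<open>\<phi> c = 3 * k\<close>, then
  \<open>c + a\<close> wraps around to level 0 and has a center on level 3.\<close>

lemma center_fibre:
  assumes "c \<in> centers"
  shows "center -` {c} = {c, c - a, c - b} \<union> (if \<phi> c = 3 then {c - (b + b - a)} else {})
    \<union> (if \<phi> c = 3 * k \<and> p = 3 * k + 2 then {c + a} else {})" (is "_ = ?R")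
proof
  have c: "\<phi> c \<ge> 3" "\<phi> c \<le> 3 * k" "\<phi> c mod 3 = 0"
    using assms by (auto simp: mem_centers_iff)
  then obtain i where i: "\<phi> c = 3 * i"
    by (auto simp: mod_eq_0_iff_dvd elim: dvdE)
  obtain n where n: "\<phi> c = 3 * n + 3" "n < k"
  proof
    show "\<phi> c = 3 * (i - 1) + 3" "i - 1 < k"
      using c i by auto
  qed
  have "\<phi> (c - a) = 3 * n + 2" "\<phi> (c - b) = 3 * n + 1"
    using n diff_a[of c] diff_b[of c] by simp_all
  moreover have "(3 * n + 2) mod 3 = 2" "(3 * n + 1) mod 3 = 1"
    by presburger+
  moreover have "3 * n + 2 \<noteq> 3 * k + 1" "3 * n + 1 \<noteq> 3 * k + 1"
    using n by presburger+
  ultimately have ca: "center (c - a) = c" and cb: "center (c - b) = c"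
    by (simp_all add: center_def)
  show "?R \<subseteq> center -` {c}"
  proof (intro Un_least)
    show "{c, c - a, c - b} \<subseteq> center -` {c}"
      using center_fixed[OF assms] ca cb by simp
    have "center (c - (b + b - a)) = c" if "\<phi> c = 3"
      using diff_bba[OF that] by (simp add: center_def)
    then show "(if \<phi> c = 3 then {c - (b + b - a)} else {}) \<subseteq> center -` {c}"
      by (cases "\<phi> c = 3") simp_all
    have "center (c + a) = c" if "\<phi> c = 3 * k \<and> p = 3 * k + 2"
      using add_a[of c] that by (simp add: center_def)
    then show "(if \<phi> c = 3 * k \<and> p = 3 * k + 2 then {c + a} else {}) \<subseteq> center -` {c}"
      by (cases "\<phi> c = 3 * k \<and> p = 3 * k + 2") simp_all
  qed
  show "center -` {c} \<subseteq> ?R"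
  proof
    fix v assume "v \<in> center -` {c}"
    then have v: "center v = c" by simp
    \<comment> \<open>The level is kept only in the two exceptional branches; in the others
      \<open>v\<close> already lies in the triangle of \<open>c\<close>.\<close>
    consider "\<phi> v = 0" "c = v + (b + b - a)" | "\<phi> v = 3 * k + 1" "c = v - a"
      | "c = v" | "c = v + b" | "c = v + a"
      using v unfolding center_def by metis
    then show "v \<in> ?R"
    proof cases
      case 1
      then show ?thesis using add_bba[of v] by simp
    next
      case 2
      then have "\<phi> c = 3 * k" "p = 3 * k + 2" using diff_a[of v] less[of v] p by auto
      then show ?thesis using 2 by simp
    qed auto
  qed
qed

text \<open>The points of a class lie on distinct levels. Since \<open>k \<ge> 2\<close>, the levels
  3 and \<open>3 * k\<close> differ, so no class receives both extra points.\<close>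

lemma card_center_fibre:
  assumes "c \<in> centers"
  shows "card (center -` {c}) \<in> {3, 4}"
proof -
  have c: "\<phi> c \<ge> 3" "\<phi> c \<le> 3 * k"
    using assms by (auto simp: mem_centers_iff)
  have d: "\<phi> (c - a) = \<phi> c - 1" "\<phi> (c - b) = \<phi> c - 2"
    using c diff_a[of c] diff_b[of c] by auto
  then have "\<phi> c \<noteq> \<phi> (c - a)" "\<phi> c \<noteq> \<phi> (c - b)" "\<phi> (c - a) \<noteq> \<phi> (c - b)"
    using c by linarith+
  then have ne: "c \<noteq> c - a" "c \<noteq> c - b" "c - a \<noteq> c - b"
    by metis+
  define T where "T = {c, c - a, c - b}"
  have card_T: "card T = 3" "finite T"
    unfolding T_def using ne by simp_all
  have fibre: "center -` {c} = T \<union> (if \<phi> c = 3 then {c - (b + b - a)} else {})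
      \<union> (if \<phi> c = 3 * k \<and> p = 3 * k + 2 then {c + a} else {})"
    unfolding T_def by (rule center_fibre[OF assms])
  consider "\<phi> c = 3" | "\<phi> c = 3 * k \<and> p = 3 * k + 2" "\<phi> c \<noteq> 3"
    | "\<phi> c \<noteq> 3" "\<not> (\<phi> c = 3 * k \<and> p = 3 * k + 2)"
    by blast
  then show ?thesis
  proof cases
    case 1
    have "\<phi> (c - (b + b - a)) \<notin> \<phi> ` T"
      using diff_bba[OF 1] 1 d by (simp add: T_def)
    then have "c - (b + b - a) \<notin> T" by blast
    moreover have "center -` {c} = insert (c - (b + b - a)) T"
      using 1 k unfolding fibre by simp
    ultimately show ?thesis using card_T by (simp only: card_insert_disjoint) simp
  next
    case 2
    have "\<phi> (c + a) \<notin> \<phi> ` T"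
      using add_a[of c] 2 d c by (auto simp: T_def)
    then have "c + a \<notin> T" by blast
    moreover have "center -` {c} = insert (c + a) T"
      using 2 unfolding fibre by simp
    ultimately show ?thesis using card_T by (simp only: card_insert_disjoint) simp
  next
    case 3
    then have "center -` {c} = T"
      unfolding fibre by (simp only: if_False Un_empty_right)
    then show ?thesis using card_T by simp
  qed
qed

lemma partition_triangle_classes: "partition_on UNIV triangle_classes"
proof (rule partition_onI)
  show "\<Union> triangle_classes = UNIV"
    using center_in_centers by (auto simp: triangle_classes_def)
  show "disjnt C D" if "C \<in> triangle_classes" "D \<in> triangle_classes" "C \<noteq> D" for C D
    using that by (auto simp: triangle_classes_def disjnt_def)
  show "{} \<notin> triangle_classes"
    using center_fixed by (fastforce simp: triangle_classes_def)
qed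

section \<open>Number of classes\<close>

lemma card_level: "j < p \<Longrightarrow> card (\<phi> -` {j}) = card (\<phi> -` {0})"
proof (induction j)
  case (Suc j)
  have "bij_betw (\<lambda>v. v + a) (\<phi> -` {j}) (\<phi> -` {Suc j})"
  proof (rule bij_betw_byWitness[where f' = "\<lambda>v. v - a"])
    show "(\<lambda>v. v + a) ` (\<phi> -` {j}) \<subseteq> \<phi> -` {Suc j}"
      using Suc.prems by (auto simp: add_a)
    show "(\<lambda>v. v - a) ` (\<phi> -` {Suc j}) \<subseteq> \<phi> -` {j}"
      using Suc.prems by (auto simp: diff_a)
  qed auto
  then show ?case
    using Suc by (simp add: bij_betw_same_card[symmetric])
qed simp

lemma card_levels:
  assumes "J \<subseteq> {..<p}"
  shows "card (\<phi> -` J) = card J * card (\<phi> -` {0})"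
proof -
  have "finite J" using assms finite_subset by blast
  have "\<phi> -` J = (\<Union>j\<in>J. \<phi> -` {j})" by blast
  also have "card \<dots> = (\<Sum>j\<in>J. card (\<phi> -` {j}))"
    using \<open>finite J\<close> by (intro card_UN_disjoint) auto
  also have "\<dots> = (\<Sum>j\<in>J. card (\<phi> -` {0}))"
    using assms by (intro sum.cong refl card_level) auto
  finally show ?thesis
    by simp
qed

text \<open>Classes correspond to their centers, which fill \<open>k\<close> of the \<open>p\<close>
  levels, and all levels have the same size.\<close>

lemma card_triangle_classes: "p * card triangle_classes = k * CARD('g)"
proof -
  have "inj_on (\<lambda>c. center -` {c}) centers"
  proof (rule inj_onI)
    fix c d assume *: "c \<in> centers" "d \<in> centers" "center -` {c} = center -` {d}"
    then have "c \<in> center -` {d}" using center_fixed[of c] by auto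
    then show "c = d" using center_fixed[OF *(1)] by simp
  qed
  then have "card triangle_classes = card centers"
    by (simp add: triangle_classes_def card_image)
  also have "\<dots> = card (\<phi> -` ((\<lambda>i. 3 * i) ` {1..k}))"
    by (simp add: centers_def vimage_def)
  also have "\<dots> = k * card (\<phi> -` {0})"
    using p by (subst card_levels) (auto simp: card_image inj_on_def)
  finally have "card triangle_classes = k * card (\<phi> -` {0})" .
  moreover have "CARD('g) = p * card (\<phi> -` {0})"
    using card_levels[of "{..<p}"] less by (simp add: vimage_def)
  ultimately show ?thesis
    by simp
qed

lemma card_triangle_class: "C \<in> triangle_classes \<Longrightarrow> card C \<in> {3, 4}"
  using card_center_fibre by (auto simp: triangle_classes_def)

section \<open>Sets containing two points of a class\<close>

lemma not_rainbow_if_center_eq: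
  assumes "center u = center v" "u \<noteq> v" "u \<in> e" "v \<in> e"
  shows "\<not> rainbow triangle_classes e"
proof -
  have "\<exists>C\<in>triangle_classes. u \<in> C \<and> v \<in> C"
    using assms(1) center_in_centers[of u] by (auto simp: triangle_classes_def)
  then show ?thesis
    using assms unfolding rainbow_def by blast
qed

text \<open>Below level \<open>3 * k\<close>, the residue of \<open>\<phi> t\<close> modulo 3
  selects two points that round up to the same center: \<open>t + a\<close> and \<open>t + b\<close>
  for residue 0, \<open>t\<close> and \<open>t + b\<close> for 1, \<open>t\<close> and
  \<open>t + a\<close> for 2. The remaining levels rely on the extra points.\<close>

lemma triangle_not_rainbow: "\<not> rainbow triangle_classes {t, t + a, t + b}"
proof -
  have ne: "t \<noteq> t + a" "t \<noteq> t + b" "t + a \<noteq> t + b"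
    using add[of 0 0] a b k p by auto
  consider "center t = center (t + a)" | "center t = center (t + b)" | "center (t + a) = center (t + b)"
  proof -
    consider "\<phi> t + 1 = p" | "\<phi> t = 3 * k" "p = 3 * k + 2" | "\<phi> t < 3 * k"
      using p less[of t] by linarith
    then show thesis
    proof cases
      \<comment> \<open>Here \<open>t + a\<close> is on level 0 and \<open>t + b\<close> on level 1;
        the shift \<open>b + b - a\<close> chosen for level 0 sends the former to
        \<open>t + b + b\<close>, which is the center of the latter.\<close>
      case 1
      then have "center (t + a) = center (t + b)"
        using k by (simp add: center_def add_a add_b)
      then show thesis using that by blast
    next
      case 2
      then have "center t = center (t + a)"
        using k by (simp add: center_def add_a)
      then show thesis using that by blast
    next
      case 3
      consider "\<phi> t mod 3 = 0" | "\<phi> t mod 3 = 1" | "\<phi> t mod 3 = 2" by linarith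
      then show thesis
      proof cases
        case m: 1
        then have "(\<phi> t + 1) mod 3 = 1" "(\<phi> t + 2) mod 3 = 2" "\<phi> t + 3 \<le> 3 * k"
          using 3 by presburger+
        moreover from this have "\<phi> t + 1 \<noteq> p" "\<phi> t + 2 \<noteq> p" using p by linarith+
        ultimately have "center (t + a) = t + a + b" "center (t + b) = t + b + a"
          by (simp_all add: center_def add_a add_b)
        then have "center (t + a) = center (t + b)"
          by (simp add: ac_simps)
        then show thesis using that by blast
      next
        case m: 2
        then have "(\<phi> t + 2) mod 3 = 0" "\<phi> t + 2 \<le> 3 * k" "\<phi> t > 0"
          using m 3 by presburger+
        moreover from this have "\<phi> t + 1 \<noteq> p" "\<phi> t + 2 \<noteq> p" using p by linarith+
        ultimately have "center t = center (t + b)"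
          using m by (simp add: center_def add_b)
        then show thesis using that by blast
      next
        case m: 3
        then have "(\<phi> t + 1) mod 3 = 0" "\<phi> t + 1 \<le> 3 * k" "\<phi> t > 0"
          using m 3 by presburger+
        moreover from this have "\<phi> t + 1 \<noteq> p" using p by linarith
        ultimately have "center t = center (t + a)"
          using m by (simp add: center_def add_a)
        then show thesis using that by blast
      qed
    qed
  qed
  then show ?thesis
  proof cases
    case 1
    then show ?thesis by (rule not_rainbow_if_center_eq) (use ne in simp_all)
  next
    case 2
    then show ?thesis by (rule not_rainbow_if_center_eq) (use ne in simp_all)
  next
    case 3
    then show ?thesis by (rule not_rainbow_if_center_eq) (use ne in simp_all)
  qed
qed

lemma level_0_not_rainbow: "\<phi> v = 0 \<Longrightarrow> \<not> rainbow triangle_classes {v, v + (b + b - a)}"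
proof -
  assume v: "\<phi> v = 0"
  then have "center v = center (v + (b + b - a))"
    using add_bba[of v] k by (simp add: center_def)
  moreover have "v \<noteq> v + (b + b - a)"
  proof
    assume "v = v + (b + b - a)"
    then have "\<phi> v = 3" using add_bba[OF v] by (rule ssubst)
    then show False using v by simp
  qed
  ultimately show ?thesis
    by (rule not_rainbow_if_center_eq) simp_all
qed

end

section \<open>Affine and projective planes\<close>

lemma rainbow_mono: "rainbow P e \<Longrightarrow> e' \<subseteq> e \<Longrightarrow> rainbow P e'"
  unfolding rainbow_def by blast

lemma balanced_coloringI:
  assumes "\<And>C. C \<in> P \<Longrightarrow> card C \<in> {3, 4}"
  shows "balanced_coloring P"
  unfolding balanced_coloring_def
proof (intro ballI)
  fix C D assume "C \<in> P" "D \<in> P"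
  from assms[OF this(1)] assms[OF this(2)] show "\<bar>int (card C) - int (card D)\<bar> \<le> 1"
    by auto
qed

text \<open>\<open>Max\<close> bounds its members only on a finite set; over a finite vertex type
  there are finitely many sets of classes, hence finitely many values of \<open>N\<close>.\<close>

lemma card_le_balanced_upper_chromatic_number:
  fixes V :: "'v::finite set" and P :: "'v set set"
  assumes "partition_on V P" "proper_coloring E P" "balanced_coloring P"
  shows "card P \<le> balanced_upper_chromatic_number V E"
  unfolding balanced_upper_chromatic_number_def
proof (rule Max_ge)
  let ?S = "{N. \<exists>P. strict_coloring V N P \<and> proper_coloring E P \<and> balanced_coloring P}"
  have "?S \<subseteq> range (card :: 'v set set \<Rightarrow> nat)"
    by (auto simp: strict_coloring_def)
  then show "finite ?S"
    by (rule finite_subset) simp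
  show "card P \<in> ?S"
    using assms by (auto simp: strict_coloring_def)
qed

text \<open>Greedy choice: quadruples are split off while the excess \<open>r\<close> is positive,
  then triples. It serves to color the ideal points.\<close>

lemma partition_into_triples_and_quadruples:
  assumes "finite A" "card A = 3 * m + r" "r \<le> m"
  shows "\<exists>P. partition_on A P \<and> card P = m \<and> (\<forall>C\<in>P. card C \<in> {3, 4})"
  using assms
proof (induction m arbitrary: A r)
  case 0
  then show ?case by (intro exI[of _ "{}"]) (simp add: partition_on_empty)
next
  case (Suc m)
  define s where "s = (if r = 0 then 3 else 4 :: nat)"
  have "s \<le> card A"
    using Suc.prems by (auto simp: s_def)
  then obtain B where B: "B \<subseteq> A" "card B = s" "finite B"
    by (rule obtain_subset_with_card_n)
  \<comment> \<open>For \<open>r = 0\<close> a triple is removed, and truncated subtraction keeps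
    the excess at 0.\<close>
  have "card (A - B) = 3 * m + (r - 1)"
    using B Suc.prems by (auto simp: card_Diff_subset s_def)
  then obtain P where P: "partition_on (A - B) P" "card P = m" "\<forall>C\<in>P. card C \<in> {3, 4}"
    using Suc.IH[of "A - B" "r - 1"] Suc.prems by force
  have [simp]: "B \<noteq> {}" using B by (auto simp: s_def split: if_splits)
  have disj: "disjnt B (\<Union> P)"
    using partition_onD1[OF P(1)] by (auto simp: disjnt_def)
  then have "B \<notin> P" using \<open>B \<noteq> {}\<close> unfolding disjnt_def by blast
  have "finite P"
    using P(1) Suc.prems(1) by (intro finite_elements[of "A - B"]) auto
  show ?case
  proof (intro exI conjI)
    show "partition_on A (insert B P)"
      using B P disj by (simp add: partition_on_insert)
    show "card (insert B P) = Suc m"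
      using \<open>B \<notin> P\<close> \<open>finite P\<close> P(2) by simp
    show "\<forall>C\<in>insert B P. card C \<in> {3, 4}"
      using P(3) B(2) by (auto simp: s_def)
  qed
qed

section \<open>Coloring the affine plane\<close>

lemma planar_function_diff_inj:
  assumes "planar_function f" "a \<noteq> 0" "f (x + a) - f x = f (y + a) - f y"
  shows "x = y"
  using assms unfolding planar_function_def by metis

text \<open>The exact class sizes are kept, not just balancedness, so that ideal classes of the same
  sizes can be added later.\<close>

lemma affine_coloring_exists:
  fixes f :: "'a::{field,finite} \<Rightarrow> 'a"
  assumes p: "prime p" "p > 5" and char: "of_nat p = (0 :: 'a)" and planar: "planar_function f"
  obtains P where "partition_on affine_points P" "proper_coloring (affine_lines f) P"
    "\<And>C. C \<in> P \<Longrightarrow> card C \<in> {3, 4}" "p * card P = (p div 3) * CARD('a)\<^sup>2"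
proof -
  obtain \<psi> :: "'a \<Rightarrow> int"
    where \<psi>_add: "\<And>x y. [\<psi> (x + y) = \<psi> x + \<psi> y] (mod int p)"
      and \<psi>_of_int: "\<And>i. [\<psi> (of_int i) = i] (mod int p)"
    using additive_functional_exists[OF p(1) char] by blast
  \<comment> \<open>With these names \<open>b = (1, \<beta>)\<close> and
    \<open>b + b - a = (0, y0)\<close>. Planarity for the shift \<open>1\<close> gives
    \<open>y0 \<noteq> 0\<close>, so the two vectors form a basis over the field.\<close>
  define \<beta> where "\<beta> = f 1 - f 0"
  define y0 where "y0 = \<beta> - (f (1 + 1) - f 1)"
  define a where "a = (1 + 1 :: 'a, f (1 + 1) - f 0)"
  define b where "b = (1 :: 'a, f 1 - f 0)"
  have "y0 \<noteq> 0"
  proof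
    assume "y0 = 0"
    then have "\<beta> = f (1 + 1) - f 1"
      unfolding y0_def by (simp only: right_minus_eq)
    then have "f (0 + 1) - f 0 = f (1 + 1) - f 1"
      by (simp only: \<beta>_def add_0)
    then have "(0 :: 'a) = 1"
      by (rule planar_function_diff_inj[OF planar one_neq_zero])
    then show False by simp
  qed
  \<comment> \<open>The arguments of \<open>\<psi>\<close> are the coordinates of \<open>v\<close>
    in the basis \<open>b\<close>, \<open>b + b - a\<close>. The weights 2 and 3 are the values
    prescribed there by \<open>\<phi> a = 1\<close> and \<open>\<phi> b = 2\<close>.\<close>
  define \<phi> where "\<phi> v = nat ((2 * \<psi> (fst v) + 3 * \<psi> ((snd v - \<beta> * fst v) / y0)) mod int p)"
    for v :: "'a \<times> 'a"
  have "p > 0" using p by simp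
  have int_\<phi>: "[int (\<phi> v) = 2 * \<psi> (fst v) + 3 * \<psi> ((snd v - \<beta> * fst v) / y0)] (mod int p)" for v
    using \<open>p > 0\<close> by (simp add: \<phi>_def cong_def)
  have \<phi>_less: "\<phi> v < p" for v
    using \<open>p > 0\<close> by (simp add: \<phi>_def nat_less_iff)
  have \<phi>_eqI: "\<phi> v = n" if "[int (\<phi> v) = int n] (mod int p)" "n < p" for v n
    using that \<phi>_less[of v] by (simp add: cong_int_iff cong_less_modulus_unique_nat)
  have \<phi>_add: "\<phi> (u + v) = (\<phi> u + \<phi> v) mod p" for u v
  proof (rule \<phi>_eqI)
    define u' v' where "u' = (snd u - \<beta> * fst u) / y0" and "v' = (snd v - \<beta> * fst v) / y0"
    have *: "(snd (u + v) - \<beta> * fst (u + v)) / y0 = u' + v'"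
      by (simp add: u'_def v'_def add_divide_distrib diff_divide_distrib distrib_left)
    have "[int (\<phi> (u + v)) = 2 * \<psi> (fst u + fst v) + 3 * \<psi> (u' + v')] (mod int p)"
      using int_\<phi>[of "u + v"] unfolding * unfolding fst_add .
    also have "[2 * \<psi> (fst u + fst v) + 3 * \<psi> (u' + v')
        = 2 * (\<psi> (fst u) + \<psi> (fst v)) + 3 * (\<psi> u' + \<psi> v')] (mod int p)"
      by (intro cong_add cong_mult \<psi>_add cong_refl)
    also have "2 * (\<psi> (fst u) + \<psi> (fst v)) + 3 * (\<psi> u' + \<psi> v')
        = (2 * \<psi> (fst u) + 3 * \<psi> u') + (2 * \<psi> (fst v) + 3 * \<psi> v')"
      by simp
    also have "[\<dots> = int (\<phi> u) + int (\<phi> v)] (mod int p)"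
      unfolding u'_def v'_def by (intro cong_add cong_sym[OF int_\<phi>])
    also have "[int (\<phi> u) + int (\<phi> v) = int ((\<phi> u + \<phi> v) mod p)] (mod int p)"
      by (simp add: cong_def zmod_int)
    finally show "[int (\<phi> (u + v)) = int ((\<phi> u + \<phi> v) mod p)] (mod int p)" .
  qed (use \<open>p > 0\<close> in simp)
  have \<phi>_a: "\<phi> a = 1"
  proof (rule \<phi>_eqI)
    \<comment> \<open>As \<open>a = 2b - (2b - a)\<close>, its coordinates are 2 and -1, and
      \<open>2 * 2 - 3 = 1\<close>.\<close>
    have "(snd a - \<beta> * fst a) / y0 = of_int (- 1)" "fst a = of_int 2"
      using \<open>y0 \<noteq> 0\<close> by (simp_all add: a_def y0_def \<beta>_def field_simps)
    then have "[int (\<phi> a) = 2 * \<psi> (of_int 2) + 3 * \<psi> (of_int (- 1))] (mod int p)"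
      using int_\<phi>[of a] by (simp only:)
    also have "[2 * \<psi> (of_int 2) + 3 * \<psi> (of_int (- 1)) = 2 * 2 + 3 * (- 1)] (mod int p)"
      by (intro cong_add cong_mult \<psi>_of_int cong_refl)
    finally show "[int (\<phi> a) = int 1] (mod int p)" by simp
  qed (use p in simp)
  have \<phi>_b: "\<phi> b = 2"
  proof (rule \<phi>_eqI)
    have "(snd b - \<beta> * fst b) / y0 = of_int 0" "fst b = of_int 1"
      by (simp_all add: b_def \<beta>_def)
    then have "[int (\<phi> b) = 2 * \<psi> (of_int 1) + 3 * \<psi> (of_int 0)] (mod int p)"
      using int_\<phi>[of b] by (simp only:)
    also have "[2 * \<psi> (of_int 1) + 3 * \<psi> (of_int 0) = 2 * 1 + 3 * 0] (mod int p)"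
      by (intro cong_add cong_mult \<psi>_of_int cong_refl)
    finally show "[int (\<phi> b) = int 2] (mod int p)" by simp
  qed (use p in simp)
  have "p mod 3 \<noteq> 0"
    using p primes_dvd_imp_eq[of 3 p] by (auto simp: mod_eq_0_iff_dvd)
  then have "p = 3 * (p div 3) + 1 \<or> p = 3 * (p div 3) + 2" "p div 3 \<ge> 2"
    using p(2) by presburger+
  then interpret triangle_coloring p "p div 3" \<phi> a b
    using \<phi>_less \<phi>_add \<phi>_a \<phi>_b by unfold_locales auto
  have vertical: "\<not> rainbow triangle_classes (vertical_line c)" for c
  proof -
    have "coprime 3 (int p)"
      using assms(1,2) primes_coprime[of 3 "int p"] by simp
    then obtain j where j: "[3 * j = 1] (mod int p)"
      using cong_solve_coprime_int by blast
    \<comment> \<open>Moving along the vertical line by \<open>i\<close> times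
      \<open>(0, y0)\<close> changes the level by \<open>3 * i\<close>; as 3 is invertible modulo
      \<open>p\<close>, this \<open>i\<close> yields a point on level 0.\<close>
    define i where "i = j * (- 2 * \<psi> c)"
    define v where "v = (c, \<beta> * c + y0 * of_int i)"
    have "[int (\<phi> v) = 2 * \<psi> c + 3 * \<psi> (of_int i)] (mod int p)"
      using int_\<phi>[of v] \<open>y0 \<noteq> 0\<close> by (simp add: v_def)
    also have "[2 * \<psi> c + 3 * \<psi> (of_int i) = 2 * \<psi> c + 3 * i] (mod int p)"
      by (intro cong_add cong_mult \<psi>_of_int cong_refl)
    also have "2 * \<psi> c + 3 * i = 2 * \<psi> c + (3 * j) * (- 2 * \<psi> c)"
      by (simp add: i_def)
    also have "[\<dots> = 2 * \<psi> c + 1 * (- 2 * \<psi> c)] (mod int p)"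
      by (intro cong_add cong_mult j cong_refl)
    finally have "\<phi> v = 0"
      using \<phi>_eqI[of v 0] \<open>p > 0\<close> by simp
    from level_0_not_rainbow[OF this] show ?thesis
      by (rule contrapos_nn, elim rainbow_mono)
        (auto simp: vertical_line_def v_def a_def b_def prod_eq_iff)
  qed
  have translate: "\<not> rainbow triangle_classes (translate_line f s r)" for s r
  proof -
    define t where "t = (0 + s, f 0 + r)"
    have "t + a = (1 + 1 + s, f (1 + 1) + r)" "t + b = (1 + s, f 1 + r)"
      by (simp_all add: t_def a_def b_def algebra_simps)
    then have "{t, t + a, t + b} \<subseteq> translate_line f s r"
      unfolding translate_line_def t_def by blast
    with triangle_not_rainbow[of t] show ?thesis
      using rainbow_mono by blast
  qed
  show thesis
  proof (rule that)
    show "partition_on affine_points triangle_classes"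
      using partition_triangle_classes by (simp add: affine_points_def)
    show "proper_coloring (affine_lines f) triangle_classes"
      using vertical translate
      by (auto simp: proper_coloring_def affine_lines_def parallel_classes_def)
    show "p * card triangle_classes = (p div 3) * CARD('a)\<^sup>2"
      using card_triangle_classes by (simp add: power2_eq_square)
  qed (rule card_triangle_class)
qed

section \<open>Coloring the projective plane\<close>

text \<open>If the classes for \<open>a \<noteq> a'\<close> coincided, the difference of
  \<open>f\<close> for the shift \<open>a' - a\<close> would take equal values at 0 and 1, against
  planarity. No translate of the graph is vertical, as it contains points with different first
  coordinates.\<close>

lemma card_parallel_classes:
  fixes f :: "'a::{field,finite} \<Rightarrow> 'a"
  assumes "planar_function f"
  shows "card (parallel_classes f) = CARD('a) + 1"
proof -
  have "inj (\<lambda>a. range (translate_line f a))"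
  proof (rule injI, rule ccontr)
    fix a a' assume eq: "range (translate_line f a) = range (translate_line f a')" and ne: "a \<noteq> a'"
    then obtain c where c: "translate_line f a 0 = translate_line f a' c"
      by (metis (mono_tags, lifting) image_iff rangeI)
    have *: "f (x - a) = f (x - a') + c" for x
    proof -
      have "(x - a + a, f (x - a) + 0) \<in> translate_line f a' c"
        unfolding c[symmetric] unfolding translate_line_def
        by (intro CollectI exI[of _ "x - a"]) simp
      then obtain z where "x = z + a'" "f (x - a) = f z + c"
        by (auto simp: translate_line_def)
      then show ?thesis by simp
    qed
    have "f (0 + (a' - a)) - f 0 = f (1 + (a' - a)) - f 1"
      using *[of a'] *[of "1 + a'"] by (simp add: algebra_simps)
    then have "(0::'a) = 1"
      by (rule planar_function_diff_inj[OF assms, rotated]) (use ne in simp)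
    then show False by simp
  qed
  moreover have "range vertical_line \<noteq> range (translate_line f a)" for a
  proof
    assume "range vertical_line = range (translate_line f a)"
    then obtain c where c: "translate_line f a 0 = vertical_line c"
      by (metis (mono_tags, lifting) image_iff rangeI)
    have "(x + a, f x + 0) \<in> vertical_line c" for x
      unfolding c[symmetric] by (auto simp: translate_line_def)
    from this[of 0] this[of 1] show False
      by (auto simp: vertical_line_def)
  qed
  ultimately show ?thesis
    by (auto simp: parallel_classes_def card_insert_if card_image)
qed

lemma partition_on_Plus:
  assumes "partition_on A P" "partition_on B D"
  shows "partition_on (Inl ` A \<union> Inr ` B) ((`) Inl ` P \<union> (`) Inr ` D)"
proof (rule partition_onI)
  show "\<Union> ((`) Inl ` P \<union> (`) Inr ` D) = Inl ` A \<union> Inr ` B"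
    using partition_onD1[OF assms(1)] partition_onD1[OF assms(2)] by auto
  show "{} \<notin> (`) Inl ` P \<union> (`) Inr ` D"
    using partition_onD3[OF assms(1)] partition_onD3[OF assms(2)] by auto
  have *: "C \<inter> C' = {}" if "C \<in> P" "C' \<in> P" "C \<noteq> C'" for C C'
    using partition_onD2[OF assms(1)] that by (auto simp: disjoint_def)
  have **: "C \<inter> C' = {}" if "C \<in> D" "C' \<in> D" "C \<noteq> C'" for C C'
    using partition_onD2[OF assms(2)] that by (auto simp: disjoint_def)
  fix X Y assume "X \<in> (`) Inl ` P \<union> (`) Inr ` D" "Y \<in> (`) Inl ` P \<union> (`) Inr ` D" "X \<noteq> Y"
  then show "disjnt X Y"
  proof (elim UnE imageE)
    fix C C' assume "X \<noteq> Y" "X = Inl ` C" "C \<in> P" "Y = Inl ` C'" "C' \<in> P"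
    then show "disjnt X Y" using *[of C C'] by (auto simp: disjnt_def)
  next
    fix C C' assume "X \<noteq> Y" "X = Inr ` C" "C \<in> D" "Y = Inr ` C'" "C' \<in> D"
    then show "disjnt X Y" using **[of C C'] by (auto simp: disjnt_def)
  qed (auto simp: disjnt_def)
qed

text \<open>An extended affine line inherits a monochromatic pair of affine points; the ideal line
  contains every class of \<open>D\<close>, and one of them has two points.\<close>

lemma proper_coloring_projective:
  assumes "proper_coloring (affine_lines f) P"
    and "partition_on (parallel_classes f) D" "\<And>C. C \<in> D \<Longrightarrow> card C \<ge> 2" "D \<noteq> {}"
  shows "proper_coloring (projective_lines f) ((`) Inl ` P \<union> (`) Inr ` D)"
  unfolding proper_coloring_def
proof
  fix e assume "e \<in> projective_lines f"
  then consider "e = ideal_line f"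
    | K l where "K \<in> parallel_classes f" "l \<in> K" "e = insert (Inr K) (Inl ` l)"
    unfolding projective_lines_def by blast
  then show "\<not> rainbow ((`) Inl ` P \<union> (`) Inr ` D) e"
  proof cases
    case 1
    obtain C where C: "C \<in> D" "card C \<ge> 2" using assms(3,4) by blast
    then obtain x y where xy: "x \<in> C" "y \<in> C" "x \<noteq> y"
      using card_le_Suc0_iff_eq[of C] by (cases "finite C") auto
    have "C \<subseteq> parallel_classes f"
      using C(1) partition_onD1[OF assms(2)] by blast
    with xy have "Inr x \<in> e" "Inr y \<in> e" "Inr x \<noteq> Inr y"
      unfolding 1 ideal_line_def by auto
    moreover have "Inr x \<in> Inr ` C" "Inr y \<in> Inr ` C" "Inr ` C \<in> (`) Inl ` P \<union> (`) Inr ` D"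
      using C(1) xy by auto
    ultimately show ?thesis
      unfolding rainbow_def by metis
  next
    case 2
    then have "\<not> rainbow P l"
      using assms(1) by (auto simp: proper_coloring_def affine_lines_def)
    then obtain x y C where xy: "x \<in> l" "y \<in> l" "x \<noteq> y" "C \<in> P" "x \<in> C" "y \<in> C"
      unfolding rainbow_def by blast
    then have "Inl x \<in> e" "Inl y \<in> e" "Inl x \<noteq> Inl y"
      unfolding 2 by auto
    moreover have "Inl x \<in> Inl ` C" "Inl y \<in> Inl ` C" "Inl ` C \<in> (`) Inl ` P \<union> (`) Inr ` D"
      using xy by auto
    ultimately show ?thesis
      unfolding rainbow_def by metis
  qed
qed

lemma projective_coloring_card_le:
  fixes f :: "'a::{field,finite} \<Rightarrow> 'a"
  assumes planar: "planar_function f"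
    and P: "partition_on affine_points P" "proper_coloring (affine_lines f) P"
      "\<And>C. C \<in> P \<Longrightarrow> card C \<in> {3, 4}"
    and m: "CARD('a) + 1 = 3 * m + r" "r \<le> m" "m > 0"
  shows "card P + m \<le> chi_b_projective f"
proof -
  obtain D where D: "partition_on (parallel_classes f) D" "card D = m" "\<forall>C\<in>D. card C \<in> {3, 4}"
    using partition_into_triples_and_quadruples[of "parallel_classes f" m r] m
      card_parallel_classes[OF planar] by auto
  let ?Q = "(`) Inl ` P \<union> (`) Inr ` D"
  have "{} \<notin> P"
    using P(1) by (auto simp: partition_on_def)
  \<comment> \<open>Only the empty set is an image under both \<open>Inl\<close> and
    \<open>Inr\<close>, so nonempty classes keep the two families apart.\<close>
  have "Inl ` C \<noteq> Inr ` C'" if C: "C \<in> P" for C C'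
  proof -
    obtain x where "x \<in> C"
      using C \<open>{} \<notin> P\<close> by (metis ex_in_conv)
    then have "Inl x \<in> Inl ` C" "Inl x \<notin> Inr ` C'"
      by auto
    then show ?thesis by metis
  qed
  then have "(`) Inl ` P \<inter> (`) Inr ` D = {}"
    by blast
  then have "card ?Q = card ((`) Inl ` P :: 'a proj_point set set) + card ((`) Inr ` D :: 'a proj_point set set)"
    by (intro card_Un_disjoint) auto
  also have "\<dots> = card P + m"
    using D(2) by (simp add: card_image inj_on_def inj_image_eq_iff)
  finally have "card P + m = card ?Q" ..
  also have "card ?Q \<le> chi_b_projective f"
    unfolding chi_b_projective_def
  proof (rule card_le_balanced_upper_chromatic_number)
    show "partition_on (projective_points f) ?Q"
      unfolding projective_points_def by (rule partition_on_Plus) (fact P D)+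
    have "D \<noteq> {}" using D(2) m(3) by auto
    then show "proper_coloring (projective_lines f) ?Q"
      using D(3) by (intro proper_coloring_projective P(2) D(1)) force+
    show "balanced_coloring ?Q"
    proof (rule balanced_coloringI)
      fix C assume "C \<in> ?Q"
      then consider C' where "C = Inl ` C'" "C' \<in> P" | C' where "C = Inr ` C'" "C' \<in> D"
        by blast
      then show "card C \<in> {3, 4}"
      proof cases
        case 1
        then show ?thesis using P(3)[of C'] by (simp add: card_image)
      next
        case 2
        then show ?thesis using D(3) by (simp add: card_image)
      qed
    qed
  qed
  finally show ?thesis .
qed

section \<open>Residues of q modulo 3 and the final bounds\<close>

theorem theorem3:
  fixes p h q :: nat and f :: "'a::{field,finite} \<Rightarrow> 'a"
  assumes "prime p" and "p > 5" and "q = p ^ h" and "\<not> q mod 3 = 0"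
    and "CARD('a) = q"
    and "planar_function f"
  shows "(p mod 3 = 1 \<longrightarrow>
            real (chi_b_affine f) \<ge> (1 - 1 / real p) * real q ^ 2 / 3) \<and>
         (p mod 3 = 2 \<longrightarrow>
            real (chi_b_affine f) \<ge> (1 - 2 / real p) * real q ^ 2 / 3) \<and>
         (p mod 3 = 1 \<longrightarrow>
            real (chi_b_projective f)
              \<ge> (real q ^ 2 + real q - 1 - real q ^ 2 / real p) / 3) \<and>
         (p mod 3 = 2 \<and> odd h \<longrightarrow>
            real (chi_b_projective f)
              \<ge> (real q ^ 2 + real q + 1 - 2 * real q ^ 2 / real p) / 3) \<and>
         (p mod 3 = 2 \<and> even h \<longrightarrow>
            real (chi_b_projective f)
              \<ge> (real q ^ 2 + real q - 1 - 2 * real q ^ 2 / real p) / 3)"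
proof -
  have char: "of_nat p = (0 :: 'a)"
    using of_nat_prime_eq_0_if_card[of p h] assms(3,5) by simp
  obtain P where P: "partition_on affine_points P" "proper_coloring (affine_lines f) P"
    "\<And>C. C \<in> P \<Longrightarrow> card C \<in> {3, 4}" "p * card P = (p div 3) * q\<^sup>2"
    using affine_coloring_exists[OF assms(1,2) char assms(6)] assms(5) by metis
  have affine: "card P \<le> chi_b_affine f"
    unfolding chi_b_affine_def
    using card_le_balanced_upper_chromatic_number P balanced_coloringI by blast
  have "h \<noteq> 0"
  proof
    assume "h = 0"
    then obtain x where "(UNIV :: 'a set) = {x}"
      using assms(3,5) card_1_singletonE[of "UNIV :: 'a set"] by auto
    then have "(0 :: 'a) = 1" by (metis UNIV_I singletonD)
    then show False by simp
  qed
  then have "p \<le> q"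
    using assms(2,3) by (simp add: self_le_power)
  have card_P: "real (card P) = (p div 3) * real q ^ 2 / p"
    using arg_cong[OF P(4), of real] assms(2) by (simp add: field_simps)
  \<comment> \<open>Since 4 is 1 modulo 3, powers of 2 alternate between 1 and 2; hence the
    dependence on the parity of \<open>h\<close>.\<close>
  have one: "q mod 3 = 1" if "p mod 3 = 1 \<or> p mod 3 = 2 \<and> even h"
  proof -
    have "q mod 3 = (p mod 3) ^ h mod 3"
      using assms(3) by (simp add: power_mod)
    moreover have "2 ^ h mod 3 = (1::nat)" if "even h"
      using that power_mod[of "4::nat" 3 "h div 2"] by (auto elim!: evenE simp: power_mult)
    ultimately show ?thesis using that by auto
  qed
  have two: "q mod 3 = 2" if "p mod 3 = 2" "odd h"
  proof -
    have "q mod 3 = (p mod 3) ^ h mod 3"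
      using assms(3) by (simp add: power_mod)
    moreover obtain j where "h = 2 * j + 1" using \<open>odd h\<close> by (elim oddE)
    then have "(2::nat) ^ h = 4 ^ j * 2" by (simp add: power_mult)
    moreover have "(4 ^ j * 2) mod 3 = (2::nat)"
      using mod_mult_left_eq[of "4 ^ j" "3::nat" 2] power_mod[of "4::nat" 3 j] by simp
    ultimately show ?thesis using that by simp
  qed
  have proj_one: "real (chi_b_projective f) \<ge> card P + (real q - 1) / 3" if "q mod 3 = 1"
  proof -
    obtain m where m: "q = 3 * m + 1"
      using \<open>q mod 3 = 1\<close> by (metis mult_div_mod_eq)
    \<comment> \<open>The \<open>q + 1 = 3 * m + 2\<close> ideal points leave excess 2, and
      \<open>q \<ge> p > 5\<close> ensures \<open>m \<ge> 2\<close>.\<close>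
    then have "card P + m \<le> chi_b_projective f"
      using assms(2,5) \<open>p \<le> q\<close> by (intro projective_coloring_card_le[OF assms(6) P(1-3), of _ 2]) auto
    then have "real (card P + m) \<le> real (chi_b_projective f)"
      by (simp only: of_nat_le_iff)
    then show ?thesis unfolding m by simp
  qed
  have proj_two: "real (chi_b_projective f) \<ge> card P + (real q + 1) / 3" if "q mod 3 = 2"
  proof -
    obtain m where m: "q = 3 * m + 2"
      using \<open>q mod 3 = 2\<close> by (metis mult_div_mod_eq)
    \<comment> \<open>Here \<open>q + 1 = 3 * (m + 1)\<close>, so the ideal points split into
      triples without excess.\<close>
    then have "card P + (m + 1) \<le> chi_b_projective f"
      using assms(2,5) \<open>p \<le> q\<close> by (intro projective_coloring_card_le[OF assms(6) P(1-3), of _ 0]) auto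
    then have "real (card P + (m + 1)) \<le> real (chi_b_projective f)"
      by (simp only: of_nat_le_iff)
    then show ?thesis unfolding m by (simp add: add_divide_distrib)
  qed
  have card1: "real (card P) = (1 - 1 / real p) * real q ^ 2 / 3" if "p mod 3 = 1"
  proof -
    obtain k where k: "p = 3 * k + 1"
      using \<open>p mod 3 = 1\<close> by (metis mult_div_mod_eq)
    then have "p div 3 = k" by simp
    then have *: "real (p div 3) = (real p - 1) / 3" unfolding k by simp
    show ?thesis using assms(2) unfolding card_P * by (simp add: field_simps)
  qed
  have card2: "real (card P) = (1 - 2 / real p) * real q ^ 2 / 3" if "p mod 3 = 2"
  proof -
    obtain k where k: "p = 3 * k + 2"
      using \<open>p mod 3 = 2\<close> by (metis mult_div_mod_eq)
    then have "p div 3 = k" by simp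
    then have *: "real (p div 3) = (real p - 2) / 3" unfolding k by simp
    show ?thesis using assms(2) unfolding card_P * by (simp add: field_simps)
  qed
  have eq1: "(1 - 1 / real p) * real q ^ 2 / 3 = (real q ^ 2 - real q ^ 2 / real p) / 3"
    by (simp add: left_diff_distrib)
  have eq2: "(1 - 2 / real p) * real q ^ 2 / 3 = (real q ^ 2 - 2 * real q ^ 2 / real p) / 3"
    by (simp add: left_diff_distrib)
  show ?thesis
  proof (intro conjI impI)
    assume "p mod 3 = 1"
    then show "real (chi_b_affine f) \<ge> (1 - 1 / real p) * real q ^ 2 / 3"
      using affine card1 by linarith
  next
    assume "p mod 3 = 2"
    then show "real (chi_b_affine f) \<ge> (1 - 2 / real p) * real q ^ 2 / 3"
      using affine card2 by linarith
  next
    assume "p mod 3 = 1"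
    then have "real (card P) = (real q ^ 2 - real q ^ 2 / real p) / 3" "q mod 3 = 1"
      using card1 eq1 one by simp_all
    then show "real (chi_b_projective f) \<ge> (real q ^ 2 + real q - 1 - real q ^ 2 / real p) / 3"
      using proj_one by (simp add: add_divide_distrib diff_divide_distrib)
  next
    assume "p mod 3 = 2 \<and> odd h"
    then have "real (card P) = (real q ^ 2 - 2 * real q ^ 2 / real p) / 3" "q mod 3 = 2"
      using card2 eq2 two by simp_all
    then show "real (chi_b_projective f) \<ge> (real q ^ 2 + real q + 1 - 2 * real q ^ 2 / real p) / 3"
      using proj_two by (simp add: add_divide_distrib diff_divide_distrib)
  next
    assume "p mod 3 = 2 \<and> even h"
    then have "real (card P) = (real q ^ 2 - 2 * real q ^ 2 / real p) / 3" "q mod 3 = 1"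
      using card2 eq2 one by simp_all
    then show "real (chi_b_projective f) \<ge> (real q ^ 2 + real q - 1 - 2 * real q ^ 2 / real p) / 3"
      using proj_one by (simp add: add_divide_distrib diff_divide_distrib)
  qed
qed

end
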